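(* Let $\mathbb{D}$ be the unit disk or the complex plane, $y:\mathbb{D}\to S^{n+2}$ a Willmore surface and $z_0\in\mathbb{D}$ a base point. Let $(\mu,S)$ be an orientation reversing symmetry of the harmonic conformal Gauss map $f:\mathbb{D}\to SO^+(1,n+3)/(SO^+(1,3)\times SO(n))$ of $y$. Let $F(z,\bar z,\lambda)$ be the extended frame of $f$ with $F(z_0,\bar z_0,\lambda)=I$, let $M(\lambda)\in\Lambda O^+(1,n+3)_\sigma$ and $k(z,\bar z)\in O^+(1,3)\times O(n)$ be such that $F(\mu(z),\overline{\mu(z)},\lambda)=M(\lambda)F(z,\bar z,\lambda^{-1})k(z,\bar z)$, and let $F(z,\bar z,\lambda)=F_-(z,\lambda)F_+(z,\bar z,\lambda)$ be the Birkhoff decomposition. Then (wherever both sides are defined) $$F_-(\mu(z),\lambda)=M(\lambda)\,\overline{F_-(z,\lambda^{-1})}\cdot W_+(\bar z,\lambda),$$ where $$W_+(\bar z,\lambda)=\overline{F_+(z,\bar z,\lambda^{-1})}\cdot k(z,\bar z)\cdot\big(F_+(\mu(z),\overline{\mu(z)},\lambda)\big)^{-1}.$$ For the normalized potential $\eta=F_-^{-1}dF_-$ of $f$ one obtains $$\mu^*\eta(z,\lambda)=\overline{\eta(z,\lambda^{-1})}\,\sharp\,W_+ .$$ Moreover: (1) if $\det\hat S=1$, then $W_+$ takes values in $\Lambda^+SO^+(1,n+3,\mathbb{C})_\sigma$; (2) if $\det\hat S=-1$, then $P_2W_+$ takes values in $\Lambda^+SO^+(1,n+3,\mathbb{C}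)_\sigma$.
   Context: $\mathbb{R}^{n+4}_1$ is $\mathbb{R}^{n+4}$ with $\langle x,y\rangle=x^tI_{1,n+3}y$, $I_{1,n+3}=\mathrm{diag}(-1,1,\dots,1)$; $S^{n+2}$ is identified with the projectivized forward light cone by $x\mapsto[(1,x)]$. $O^+(1,n+3)$: $I_{1,n+3}$-orthogonal real matrices preserving the forward light cone (every conformal diffeomorphism $S$ of $S^{n+2}$ is induced by a unique $\hat S\in O^+(1,n+3)$); $SO^+(1,n+3)$: those of determinant one; $SO^+(1,n+3,\mathbb{C})$: its complexification. $P_2=\mathrm{diag}(1,1,1,1,-1,1,\dots,1)$. Conformal Gauss map and frame. For a conformal immersion $y$ with coordinate $z$, the canonical lift $Y$ is the forward light-cone valued map with $[Y]=y$, $\langle Y_z,Y_{\bar z}\rangle=\frac12$. Put $Y_z=\frac12(e_1-ie_2)$; $N$ is the section of $V=\mathrm{Span}_{\mathbb R}\{Y,\mathrm{Re}Y_z,\mathrm{Im}Y_z,Y_{z\bar z}\}$ with $\langle N,Y_z\rangle=\langle N,N\rangle=0$, $\langle N,Y\rangle=-1$; $e_0=\frac1{\sqrt2}(Y+N)$, $\hat e_0=\frac1{\sqrt2}(-Y+N)$. The oriented conformal Gauss map $f$ is $p\mapsto V_p$, oriented by $(e_0,\hat e_0,e_1,e_2)$, with values in the space of oriented 4-dimensional Lorentzian subspaces. $y$ is Willmore iff $f$ is harmonic. The frame of $f$ is $F=(e_0,\hat e_0,e_1,e_2,\psi_1,\dots,\psi_n)\in SO^+(1,n+3)$ with $\psi_j$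 an orthonormal frame of $V^\perp$. Symmetry. An orientation reversing symmetry $(\mu,S)$ consists of an anti-holomorphic automorphism $\mu$ of $\mathbb{D}$ and a conformal diffeomorphism $S$ of $S^{n+2}$, mapping $y(\mathbb{D})$ onto itself, with $y(\mu(z))=S(y(z))$. For such a symmetry matrices $M(\lambda)$, $k$ as in the claim exist, with $M(1)=\hat S$. Loop groups. $\sigma=\mathrm{Ad}(\mathrm{diag}(-I_4,I_n))$; $\mathfrak{so}(1,n+3)=\mathfrak k\oplus\mathfrak p$ the $(\pm1)$-eigenspace decomposition; $\alpha=F^{-1}dF=\alpha'_{\mathfrak p}+\alpha_{\mathfrak k}+\alpha''_{\mathfrak p}$ ($'$, $''$: $(1,0)$- and $(0,1)$-parts). The extended frame $F(z,\bar z,\lambda)$, $\lambda\in S^1$, solves $dF=F(\lambda^{-1}\alpha'_{\mathfrak p}+\alpha_{\mathfrak k}+\lambda\alpha''_{\mathfrak p})$ with $F(z_0,\bar z_0,\lambda)=I$ (the surface being normalized so that $F(z_0,\bar z_0)=I$). $\Lambda G_\sigma$: loops $\gamma:S^1\to G$ with $\sigma\gamma(\lambda)=\gamma(-\lambda)$; $\Lambda^+G_\sigma$ ($G$ complex): those extending holomorphically to $|\lambda|<1$. Birkhoff decomposition: $F_-$ extends holomorphically to $|\lambda|>1$ including $\lambda=\infty$ with $F_-(z,\infty)=I$, and $F_+\in\Lambda^+SO^+(1,n+3,\mathbb{C})_\sigma$ with $F_+|_{\lambda=0}$ in the identity component of the $\sigma$-fixed subgroup of $SO^+(1,n+3,\mathbb{C})$;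 it exists for $z$ outside a discrete subset of $\mathbb{D}$, and $F_-$ is meromorphic in $z$. Complex conjugation is entrywise for $\lambda\in S^1$. $\eta\,\sharp\,W=W^{-1}\eta W+W^{-1}dW$. *)

theory Defs
  imports "HOL-Complex_Analysis.Complex_Analysis"
begin

text \<open>
  Conventions. The integer \<open>n \<ge> 1\<close> is the cardinality of the index type \<open>'n\<close>.
  The sphere of dimension \<open>n + 2\<close> is the unit sphere of \<open>real^(3 + 'n)\<close>; coordinates of the
  Lorentz space of dimension \<open>n + 4\<close> are indexed by \<open>(3 + 'n) option\<close>, where \<open>None\<close> is the
  time-like coordinate. The first four coordinates are \<open>None\<close>, \<open>Some (Inl 0)\<close>, \<open>Some (Inl 1)\<close>,
  \<open>Some (Inl 2)\<close>; the last \<open>n\<close> are \<open>Some (Inr j)\<close>, in the order of \<open>'n\<close>.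
  A map on the surface is a function of the point \<open>z\<close>, so \<open>F(z, cnj z, \<lambda>)\<close> is written
  \<open>F z \<lambda>\<close>.
\<close>

text \<open>For open \<open>U\<close> in finite dimension; iterated directional derivatives keep the codomain fixed.\<close>

primrec Ck_on :: "nat \<Rightarrow> 'a::real_normed_vector set \<Rightarrow> ('a \<Rightarrow> 'b::real_normed_vector) \<Rightarrow> bool" where
  "Ck_on 0 U f \<longleftrightarrow> continuous_on U f"
| "Ck_on (Suc k) U f \<longleftrightarrow> (\<forall>x\<in>U. f differentiable (at x)) \<and>
     (\<forall>v. Ck_on k U (\<lambda>x. frechet_derivative f (at x) v))"

definition smooth_on :: "'a::real_normed_vector set \<Rightarrow> ('a \<Rightarrow> 'b::real_normed_vector) \<Rightarrow> bool" where
  "smooth_on U f \<longleftrightarrow> (\<forall>k. Ck_on k U f)"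

definition d_z :: "(complex \<Rightarrow> complex) \<Rightarrow> complex \<Rightarrow> complex" where
  "d_z g z = (frechet_derivative g (at z) 1 - \<i> * frechet_derivative g (at z) \<i>) / 2"

definition d_zbar :: "(complex \<Rightarrow> complex) \<Rightarrow> complex \<Rightarrow> complex" where
  "d_zbar g z = (frechet_derivative g (at z) 1 + \<i> * frechet_derivative g (at z) \<i>) / 2"

definition conformal_immersion ::
    "complex set \<Rightarrow> (complex \<Rightarrow> real^(3 + 'n::finite)) \<Rightarrow> bool" where
  "conformal_immersion D y \<longleftrightarrow> smooth_on D y \<and> y ` D \<subseteq> sphere 0 1 \<and>
     (\<forall>z\<in>D. \<exists>c>0. \<forall>v w. frechet_derivative y (at z) v \<bullet> frechet_derivative y (at z) w = c * (v \<bullet> w))"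

text \<open>A map of the unit sphere is differentiated through its extension that is constant along rays.\<close>

definition radial :: "(real^'m \<Rightarrow> real^'m) \<Rightarrow> real^'m \<Rightarrow> real^'m" where
  "radial S x = S (x /\<^sub>R norm x)"

definition conformal_diffeo_sphere :: "(real^'m \<Rightarrow> real^'m) \<Rightarrow> bool" where
  "conformal_diffeo_sphere S \<longleftrightarrow>
     bij_betw S (sphere 0 1) (sphere 0 1) \<and>
     smooth_on (- {0}) (radial S) \<and>
     smooth_on (- {0}) (radial (inv_into (sphere 0 1) S)) \<and>
     (\<forall>x\<in>sphere 0 1. \<exists>c>0. \<forall>v w. v \<bullet> x = 0 \<and> w \<bullet> x = 0 \<longrightarrow>
        frechet_derivative (radial S) (at x) v \<bullet> frechet_derivative (radial S) (at x) w = c * (v \<bullet> w))"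

definition diag_mat :: "('i \<Rightarrow> 'a) \<Rightarrow> 'a::zero^'i^'i" where
  "diag_mat d = (\<chi> i j. if i = j then d i else 0)"

definition Ilor :: "'a::comm_ring_1^('m::finite option)^('m option)" where
  "Ilor = diag_mat (\<lambda>i. case i of None \<Rightarrow> - 1 | Some _ \<Rightarrow> 1)"

definition lor :: "'a::comm_ring_1^('m::finite option) \<Rightarrow> 'a^('m option) \<Rightarrow> 'a" where
  "lor x y = scalar_product x (Ilor *v y)"

definition forward_cone :: "(real^('m::finite option)) set" where
  "forward_cone = {x. lor x x = 0 \<and> x $ None > 0}"

definition Oplus :: "(real^('m::finite option)^('m option)) set" where
  "Oplus = {A. transpose A ** Ilor ** A = Ilor \<and> (\<forall>x\<in>forward_cone. A *v x \<in> forward_cone)}"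

definition SOplus :: "(real^('m::finite option)^('m option)) set" where
  "SOplus = {A \<in> Oplus. det A = 1}"

text \<open>The complexification of \<open>SOplus\<close>; time orientation has no complex counterpart.\<close>

definition SOplusC :: "(complex^('m::finite option)^('m option)) set" where
  "SOplusC = {A. transpose A ** Ilor ** A = Ilor \<and> det A = 1}"

definition lift1 :: "real^'m::finite \<Rightarrow> real^('m option)" where
  "lift1 x = (\<chi> i. case i of None \<Rightarrow> 1 | Some j \<Rightarrow> x $ j)"

definition induces :: "real^('m::finite option)^('m option) \<Rightarrow> (real^'m \<Rightarrow> real^'m) \<Rightarrow> bool" where
  "induces A S \<longleftrightarrow> (\<forall>x\<in>sphere 0 1. \<exists>r>0. A *v lift1 x = r *\<^sub>R lift1 (S x))"

definition block_ix :: "(3 + 'n) option \<Rightarrow> 3 option + 'n" where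
  "block_ix i = (case i of None \<Rightarrow> Inl None | Some (Inl a) \<Rightarrow> Inl (Some a) | Some (Inr b) \<Rightarrow> Inr b)"

definition blockdiag ::
    "'a::zero^(3 option)^(3 option) \<Rightarrow> 'a^'n::finite^'n \<Rightarrow> 'a^((3 + 'n) option)^((3 + 'n) option)" where
  "blockdiag A B = (\<chi> i j. case (block_ix i, block_ix j) of
       (Inl a, Inl b) \<Rightarrow> A $ a $ b
     | (Inr a, Inr b) \<Rightarrow> B $ a $ b
     | _ \<Rightarrow> 0)"

definition O13_On :: "(real^((3 + 'n::finite) option)^((3 + 'n) option)) set" where
  "O13_On = {blockdiag A B | A B. A \<in> Oplus \<and> orthogonal_matrix B}"

definition SO13_SOn :: "(real^((3 + 'n::finite) option)^((3 + 'n) option)) set" where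
  "SO13_SOn = {blockdiag A B | A B. A \<in> SOplus \<and> rotation_matrix B}"

definition P2 :: "complex^((3 + 'n::{finite,linorder}) option)^((3 + 'n) option)" where
  "P2 = diag_mat (\<lambda>i. if i = Some (Inr (Min UNIV)) then - 1 else 1)"

abbreviation cmat :: "real^'i^'j \<Rightarrow> complex^'i^'j" where
  "cmat \<equiv> map_matrix complex_of_real"

abbreviation cnj_mat :: "complex^'i^'j \<Rightarrow> complex^'i^'j" where
  "cnj_mat \<equiv> map_matrix cnj"

abbreviation cscale :: "complex \<Rightarrow> complex^'i^'j \<Rightarrow> complex^'i^'j" where
  "cscale c \<equiv> map_matrix ((*) c)"

definition sigma :: "'a::field^((3 + 'n::finite) option)^((3 + 'n) option) \<Rightarrow>
    'a^((3 + 'n) option)^((3 + 'n) option)" where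
  "sigma A = blockdiag (- mat 1) (mat 1) ** A ** matrix_inv (blockdiag (- mat 1) (mat 1))"

definition lift_z :: "(complex \<Rightarrow> real^'i) \<Rightarrow> complex \<Rightarrow> complex^'i" where
  "lift_z Y z = (\<chi> i. d_z (\<lambda>w. complex_of_real (Y w $ i)) z)"

definition lift_zbar :: "(complex \<Rightarrow> real^'i) \<Rightarrow> complex \<Rightarrow> complex^'i" where
  "lift_zbar Y z = (\<chi> i. d_zbar (\<lambda>w. complex_of_real (Y w $ i)) z)"

text \<open>The vector of second derivatives \<open>d_zbar (d_z Y)\<close> is real.\<close>

definition lift_zzbar :: "(complex \<Rightarrow> real^'i) \<Rightarrow> complex \<Rightarrow> real^'i" where
  "lift_zzbar Y z = (\<chi> i. Re (d_zbar (\<lambda>w. lift_z Y w $ i) z))"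

definition canonical_lift :: "complex set \<Rightarrow> (complex \<Rightarrow> real^'m::finite) \<Rightarrow>
    (complex \<Rightarrow> real^('m option)) \<Rightarrow> bool" where
  "canonical_lift D y Y \<longleftrightarrow> smooth_on D Y \<and>
     (\<forall>z\<in>D. Y z \<in> forward_cone \<and> (\<exists>r. Y z = r *\<^sub>R lift1 (y z)) \<and>
             lor (lift_z Y z) (lift_zbar Y z) = 1 / 2)"

definition gauss_space :: "(complex \<Rightarrow> real^'i) \<Rightarrow> complex \<Rightarrow> (real^'i) set" where
  "gauss_space Y z = span {Y z, \<chi> i. Re (lift_z Y z $ i), \<chi> i. Im (lift_z Y z $ i), lift_zzbar Y z}"

definition dual_lift :: "complex set \<Rightarrow> (complex \<Rightarrow> real^('m::finite option)) \<Rightarrow>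
    (complex \<Rightarrow> real^('m option)) \<Rightarrow> bool" where
  "dual_lift D Y N \<longleftrightarrow> (\<forall>z\<in>D. N z \<in> gauss_space Y z \<and>
     lor (\<chi> i. complex_of_real (N z $ i)) (lift_z Y z) = 0 \<and> lor (N z) (N z) = 0 \<and> lor (N z) (Y z) = - 1)"

text \<open>The vectors \<open>e\<^sub>0\<close>, hat \<open>e\<^sub>0\<close>, \<open>e\<^sub>1\<close>, \<open>e\<^sub>2\<close>, in this order.\<close>

definition gauss_basis :: "(complex \<Rightarrow> real^'i) \<Rightarrow> (complex \<Rightarrow> real^'i) \<Rightarrow> complex \<Rightarrow>
    3 option \<Rightarrow> real^'i" where
  "gauss_basis Y N z a = (case a of
       None \<Rightarrow> (1 / sqrt 2) *\<^sub>R (Y z + N z)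
     | Some b \<Rightarrow> if b = 0 then (1 / sqrt 2) *\<^sub>R (- Y z + N z)
                 else if b = 1 then (\<chi> i. 2 * Re (lift_z Y z $ i))
                 else (\<chi> i. - 2 * Im (lift_z Y z $ i)))"

text \<open>
  An oriented four-dimensional Lorentzian subspace is a point of
  \<open>SO\<^sup>+(1,n+3) / (SO\<^sup>+(1,3) \<times> SO(n))\<close>, i.e. a left coset: the set of all matrices in \<open>SOplus\<close>
  whose first four columns form a positively oriented basis of the subspace.
\<close>

definition oriented_space :: "(3 option \<Rightarrow> real^((3 + 'n::finite) option)) \<Rightarrow>
    (real^((3 + 'n) option)^((3 + 'n) option)) set" where
  "oriented_space e = {G \<in> SOplus. \<exists>A :: real^(3 option)^(3 option). det A > 0 \<and>
     (\<forall>a. column (map_option Inl a) G = (\<Sum>b\<in>UNIV. A $ b $ a *\<^sub>R e b))}"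

definition conformal_gauss_map :: "complex set \<Rightarrow> (complex \<Rightarrow> real^(3 + 'n::finite)) \<Rightarrow>
    (complex \<Rightarrow> (real^((3 + 'n) option)^((3 + 'n) option)) set) \<Rightarrow> bool" where
  "conformal_gauss_map D y f \<longleftrightarrow> (\<exists>Y N. canonical_lift D y Y \<and> dual_lift D Y N \<and>
     (\<forall>z\<in>D. f z = oriented_space (gauss_basis Y N z)))"

definition gauss_frame :: "complex set \<Rightarrow> (complex \<Rightarrow> real^(3 + 'n::finite)) \<Rightarrow>
    (complex \<Rightarrow> (real^((3 + 'n) option)^((3 + 'n) option)) set) \<Rightarrow>
    (complex \<Rightarrow> real^((3 + 'n) option)^((3 + 'n) option)) \<Rightarrow> bool" where
  "gauss_frame D y f F \<longleftrightarrow> smooth_on D F \<and> (\<exists>Y N. canonical_lift D y Y \<and> dual_lift D Y N \<and>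
     (\<forall>z\<in>D. F z \<in> SOplus \<and> F z \<in> f z \<and>
        (\<forall>a. column (map_option Inl a) (F z) = gauss_basis Y N z a) \<and>
        (\<forall>j. \<forall>x\<in>gauss_space Y z. lor (column (Some (Inr j)) (F z)) x = 0) \<and>
        (\<forall>i j. lor (column (Some (Inr i)) (F z)) (column (Some (Inr j)) (F z)) = (if i = j then 1 else 0))))"

text \<open>A one-form is a function of the point and of the (real) tangent vector.\<close>

definition mc_form :: "(complex \<Rightarrow> complex^'i^'i) \<Rightarrow> complex \<Rightarrow> complex \<Rightarrow> complex^'i^'i" where
  "mc_form F z v = matrix_inv (F z) ** frechet_derivative F (at z) v"

definition part10 :: "(complex \<Rightarrow> complex^'i^'i) \<Rightarrow> complex \<Rightarrow> complex^'i^'i" where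
  "part10 \<omega> v = (1 / 2) *\<^sub>R (\<omega> v - cscale \<i> (\<omega> (\<i> * v)))"

definition part01 :: "(complex \<Rightarrow> complex^'i^'i) \<Rightarrow> complex \<Rightarrow> complex^'i^'i" where
  "part01 \<omega> v = (1 / 2) *\<^sub>R (\<omega> v + cscale \<i> (\<omega> (\<i> * v)))"

definition k_part :: "complex^((3 + 'n::finite) option)^((3 + 'n) option) \<Rightarrow>
    complex^((3 + 'n) option)^((3 + 'n) option)" where
  "k_part A = (1 / 2) *\<^sub>R (A + sigma A)"

definition p_part :: "complex^((3 + 'n::finite) option)^((3 + 'n) option) \<Rightarrow>
    complex^((3 + 'n) option)^((3 + 'n) option)" where
  "p_part A = (1 / 2) *\<^sub>R (A - sigma A)"

text \<open>
  Vanishing tension field of \<open>z \<mapsto> F z K\<close>: the tangent bundle of the symmetric space is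
  associated with the isotropy representation on the \<open>(-1)\<close>-eigenspace of \<open>sigma\<close>, its Levi-Civita connection is the canonical
  one, and \<open>part10 \<omega> 1\<close>, \<open>part01 \<omega> 1\<close> are the values of \<open>\<omega>\<close> on \<open>\<partial>/\<partial>z\<close> and on its conjugate.
\<close>

definition tension_free_at :: "(complex \<Rightarrow> real^((3 + 'n::finite) option)^((3 + 'n) option)) \<Rightarrow>
    complex \<Rightarrow> bool" where
  "tension_free_at F z \<longleftrightarrow>
     (let \<alpha> = mc_form (\<lambda>w. cmat (F w));
          A = (\<lambda>w. part10 (\<lambda>v. p_part (\<alpha> w v)) 1);
          B = part01 (\<lambda>v. k_part (\<alpha> z v)) 1
      in (\<chi> i j. d_zbar (\<lambda>w. A w $ i $ j) z) + (B ** A z - A z ** B) = 0)"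

definition harmonic_map :: "complex set \<Rightarrow>
    (complex \<Rightarrow> (real^((3 + 'n::finite) option)^((3 + 'n) option)) set) \<Rightarrow> bool" where
  "harmonic_map D f \<longleftrightarrow> (\<exists>F. smooth_on D F \<and>
     (\<forall>z\<in>D. F z \<in> SOplus \<and> f z = {F z ** h | h. h \<in> SO13_SOn} \<and> tension_free_at F z))"

definition willmore_surface :: "complex set \<Rightarrow> (complex \<Rightarrow> real^(3 + 'n::finite)) \<Rightarrow> bool" where
  "willmore_surface D y \<longleftrightarrow> conformal_immersion D y \<and>
     (\<exists>f. conformal_gauss_map D y f \<and> harmonic_map D f)"

definition alpha_lambda :: "(complex \<Rightarrow> real^((3 + 'n::finite) option)^((3 + 'n) option)) \<Rightarrow>
    complex \<Rightarrow> complex \<Rightarrow> complex \<Rightarrow> complex^((3 + 'n) option)^((3 + 'n) option)" where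
  "alpha_lambda F l z v =
     (let \<alpha> = mc_form (\<lambda>w. cmat (F w)) z
      in cscale (inverse l) (part10 (\<lambda>u. p_part (\<alpha> u)) v) + k_part (\<alpha> v)
         + cscale l (part01 (\<lambda>u. p_part (\<alpha> u)) v))"

definition extended_frame :: "complex set \<Rightarrow> complex \<Rightarrow>
    (complex \<Rightarrow> real^((3 + 'n::finite) option)^((3 + 'n) option)) \<Rightarrow>
    (complex \<Rightarrow> complex \<Rightarrow> real^((3 + 'n) option)^((3 + 'n) option)) \<Rightarrow> bool" where
  "extended_frame D z0 F0 F \<longleftrightarrow> (\<forall>l\<in>sphere 0 1. F z0 l = mat 1 \<and>
     (\<forall>z\<in>D. ((\<lambda>w. cmat (F w l)) has_derivative (\<lambda>v. cmat (F z l) ** alpha_lambda F0 l z v)) (at z)))"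

definition pullback :: "(complex \<Rightarrow> complex) \<Rightarrow> (complex \<Rightarrow> complex \<Rightarrow> 'b) \<Rightarrow>
    complex \<Rightarrow> complex \<Rightarrow> 'b" where
  "pullback \<mu> \<omega> z v = \<omega> (\<mu> z) (frechet_derivative \<mu> (at z) v)"

definition gauge :: "(complex \<Rightarrow> complex \<Rightarrow> complex^'i^'i) \<Rightarrow> (complex \<Rightarrow> complex^'i^'i) \<Rightarrow>
    complex \<Rightarrow> complex \<Rightarrow> complex^'i^'i" (infixl \<open>\<sharp>\<close> 70) where
  "(\<eta> \<sharp> W) z v = matrix_inv (W z) ** \<eta> z v ** W z + matrix_inv (W z) ** frechet_derivative W (at z) v"

definition antiholomorphic_automorphism :: "complex set \<Rightarrow> (complex \<Rightarrow> complex) \<Rightarrow> bool" where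
  "antiholomorphic_automorphism D \<mu> \<longleftrightarrow> bij_betw \<mu> D D \<and> (\<lambda>z. cnj (\<mu> z)) holomorphic_on D"

definition orientation_reversing_symmetry :: "complex set \<Rightarrow> (complex \<Rightarrow> real^(3 + 'n::finite)) \<Rightarrow>
    (complex \<Rightarrow> complex) \<Rightarrow> (real^(3 + 'n) \<Rightarrow> real^(3 + 'n)) \<Rightarrow> bool" where
  "orientation_reversing_symmetry D y \<mu> S \<longleftrightarrow>
     antiholomorphic_automorphism D \<mu> \<and> conformal_diffeo_sphere S \<and>
     S ` (y ` D) = y ` D \<and> (\<forall>z\<in>D. y (\<mu> z) = S (y z))"

text \<open>A loop is a function on the complex numbers of which only the values on the unit circle matter.\<close>

definition loop_group :: "('a::real_normed_field^((3 + 'n::finite) option)^((3 + 'n) option)) set \<Rightarrow>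
    (complex \<Rightarrow> 'a^((3 + 'n) option)^((3 + 'n) option)) set" where
  "loop_group G = {\<gamma>. continuous_on (sphere 0 1) \<gamma> \<and>
     (\<forall>l\<in>sphere 0 1. \<gamma> l \<in> G \<and> sigma (\<gamma> l) = \<gamma> (- l))}"

definition mat_holomorphic_on :: "(complex \<Rightarrow> complex^'i^'j) \<Rightarrow> complex set \<Rightarrow> bool" where
  "mat_holomorphic_on g U \<longleftrightarrow> (\<forall>i j. (\<lambda>z. g z $ i $ j) holomorphic_on U)"

definition extends_inside :: "(complex \<Rightarrow> complex^'i^'j) \<Rightarrow> (complex \<Rightarrow> complex^'i^'j) \<Rightarrow> bool" where
  "extends_inside \<gamma> g \<longleftrightarrow> continuous_on (cball 0 1) g \<and> mat_holomorphic_on g (ball 0 1) \<and>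
     (\<forall>l\<in>sphere 0 1. g l = \<gamma> l)"

definition extends_outside :: "(complex \<Rightarrow> complex^'i^'j) \<Rightarrow> (complex \<Rightarrow> complex^'i^'j) \<Rightarrow> bool" where
  "extends_outside \<gamma> g \<longleftrightarrow> continuous_on (- ball 0 1) g \<and> mat_holomorphic_on g (- cball 0 1) \<and>
     (\<forall>l\<in>sphere 0 1. g l = \<gamma> l)"

definition loop_plus :: "(complex^((3 + 'n::finite) option)^((3 + 'n) option)) set \<Rightarrow>
    (complex \<Rightarrow> complex^((3 + 'n) option)^((3 + 'n) option)) set" where
  "loop_plus G = {\<gamma> \<in> loop_group G. \<exists>g. extends_inside \<gamma> g}"

definition loop_minus_star :: "(complex^((3 + 'n::finite) option)^((3 + 'n) option)) set \<Rightarrow>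
    (complex \<Rightarrow> complex^((3 + 'n) option)^((3 + 'n) option)) set" where
  "loop_minus_star G = {\<gamma> \<in> loop_group G. \<exists>g. extends_outside \<gamma> g \<and> (g \<longlongrightarrow> mat 1) at_infinity}"

definition KC0 :: "(complex^((3 + 'n::finite) option)^((3 + 'n) option)) set" where
  "KC0 = connected_component_set {A \<in> SOplusC. sigma A = A} (mat 1)"

text \<open>\<open>X\<close> is the discrete exceptional set, off which the factors are defined.\<close>

definition birkhoff_decomposition :: "complex set \<Rightarrow> complex set \<Rightarrow>
    (complex \<Rightarrow> complex \<Rightarrow> real^((3 + 'n::finite) option)^((3 + 'n) option)) \<Rightarrow>
    (complex \<Rightarrow> complex \<Rightarrow> complex^((3 + 'n) option)^((3 + 'n) option)) \<Rightarrow>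
    (complex \<Rightarrow> complex \<Rightarrow> complex^((3 + 'n) option)^((3 + 'n) option)) \<Rightarrow> bool" where
  "birkhoff_decomposition D X F Fm Fp \<longleftrightarrow>
     X \<subseteq> D \<and> X sparse_in D \<and>
     (\<forall>z\<in>D - X.
        (\<forall>l\<in>sphere 0 1. cmat (F z l) = Fm z l ** Fp z l) \<and>
        Fm z \<in> loop_minus_star SOplusC \<and>
        Fp z \<in> loop_plus SOplusC \<and> (\<exists>g. extends_inside (Fp z) g \<and> g 0 \<in> KC0)) \<and>
     (\<forall>l\<in>sphere 0 1. mat_holomorphic_on (\<lambda>z. Fm z l) (D - X) \<and>
        (\<forall>i j. (\<lambda>z. Fm z l $ i $ j) meromorphic_on D))"

definition W_plus :: "(complex \<Rightarrow> complex) \<Rightarrow>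
    (complex \<Rightarrow> real^((3 + 'n::finite) option)^((3 + 'n) option)) \<Rightarrow>
    (complex \<Rightarrow> complex \<Rightarrow> complex^((3 + 'n) option)^((3 + 'n) option)) \<Rightarrow>
    complex \<Rightarrow> complex \<Rightarrow> complex^((3 + 'n) option)^((3 + 'n) option)" where
  "W_plus \<mu> k Fp z l = cnj_mat (Fp z (inverse l)) ** cmat (k z) ** matrix_inv (Fp (\<mu> z) l)"

definition normalized_potential :: "(complex \<Rightarrow> complex \<Rightarrow> complex^'i^'i) \<Rightarrow>
    complex \<Rightarrow> complex \<Rightarrow> complex \<Rightarrow> complex^'i^'i" where
  "normalized_potential Fm l = mc_form (\<lambda>z. Fm z l)"

end

theory Submission
  imports Defs
begin

text \<open>
  Conjugating the Birkhoff decomposition of the real matrix \<open>F z (inverse l)\<close> and inserting it into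
  the symmetry of the frame gives the formula for \<open>Fm (\<mu> z) l\<close>; solved for \<open>W\<close>, it shows that \<open>W\<close>
  is antiholomorphic in \<open>z\<close>, and its logarithmic derivative is the transformation of the potential.
  As a product of \<open>cnj (Fp z (inverse l))\<close>, \<open>k z\<close> and the inverse of \<open>Fp (\<mu> z) l\<close>, \<open>W\<close> is a plus loop
  in the complex Lorentz group: on the unit circle \<open>inverse l = cnj l\<close>, so Schwarz reflection extends
  the first factor; \<open>sigma\<close> fixes the second; and inversion is linear on the Lorentz group, so
  the third factor extends as well. The determinant of \<open>W\<close> is \<open>det (k z)\<close>, which equals \<open>det Shat\<close>
  because the frame has determinant one.
\<close>

section \<open>Matrix algebra\<close>

lemma matrix_inv_unique:
  fixes A B :: "'a::field^'n^'n"
  assumes "B ** A = mat 1"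
  shows "matrix_inv A = B"
proof -
  have "A ** B = mat 1"
    using assms matrix_left_right_inverse by blast
  then have "A ** B = mat 1 \<and> B ** A = mat 1"
    using assms by blast
  then have "A ** matrix_inv A = mat 1 \<and> matrix_inv A ** A = mat 1"
    unfolding matrix_inv_def by (rule someI)
  then show ?thesis
    by (metis assms matrix_mul_assoc matrix_mul_lid matrix_mul_rid)
qed

lemma
  fixes A :: "'a::field^'n^'n"
  assumes "invertible A"
  shows matrix_inv_left: "matrix_inv A ** A = mat 1"
    and matrix_inv_right: "A ** matrix_inv A = mat 1"
  using assms matrix_inv_unique unfolding invertible_def by metis+

lemma matrix_inv_mult:
  fixes A B :: "'a::field^'n^'n"
  assumes "invertible A" "invertible B"
  shows "matrix_inv (A ** B) = matrix_inv B ** matrix_inv A"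
proof (rule matrix_inv_unique)
  have "matrix_inv B ** matrix_inv A ** (A ** B)
      = matrix_inv B ** (matrix_inv A ** A) ** B"
    by (simp only: matrix_mul_assoc)
  then show "matrix_inv B ** matrix_inv A ** (A ** B) = mat 1"
    by (simp add: assms matrix_inv_left)
qed

lemma det_matrix_inv:
  fixes A :: "'a::field^'n^'n"
  assumes "invertible A"
  shows "det (matrix_inv A) = inverse (det A)"
  using matrix_inv_left[OF assms] by (metis det_I det_mul inverse_unique mult.commute)

lemma uminus_matrix_mult: "(- A) ** B = - (A ** B :: 'a::ring_1^'n^'m)"
  by (simp add: vec_eq_iff matrix_matrix_mult_def sum_negf)

lemma matrix_mult_uminus: "A ** (- B) = - (A ** B :: 'a::ring_1^'n^'m)"
  by (simp add: vec_eq_iff matrix_matrix_mult_def sum_negf)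

lemma diag_mat_mult: "diag_mat d ** diag_mat e = diag_mat (\<lambda>i. d i * (e i :: 'a::semiring_1))"
  by (auto simp: vec_eq_iff matrix_matrix_mult_def diag_mat_def if_distrib[of "\<lambda>x. x * _"]
      cong: if_cong)

lemma transpose_diag_mat: "transpose (diag_mat d) = diag_mat d"
  by (auto simp: vec_eq_iff transpose_def diag_mat_def)

lemma diag_mat_1: "diag_mat (\<lambda>i. 1) = mat 1"
  by (simp add: mat_def diag_mat_def)

lemma det_diag_mat: "det (diag_mat d) = (\<Prod>i\<in>UNIV. d i)"
  by (subst det_diagonal) (simp_all add: diag_mat_def)

locale field_hom =
  fixes h :: "'a::field \<Rightarrow> 'b::field"
  assumes hom_add: "h (x + y) = h x + h y"
    and hom_mult: "h (x * y) = h x * h y"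
    and hom_one: "h 1 = 1"
begin

lemma hom_zero: "h 0 = 0"
  by (metis hom_add add_0 add_cancel_right_right)

lemma hom_uminus: "h (- x) = - h x"
  using hom_add[of x "- x"] by (simp add: hom_zero eq_neg_iff_add_eq_0 add.commute)

lemma hom_sum: "h (sum f I) = (\<Sum>i\<in>I. h (f i))"
  by (induction I rule: infinite_finite_induct) (simp_all add: hom_zero hom_add)

lemma hom_prod: "h (prod f I) = (\<Prod>i\<in>I. h (f i))"
  by (induction I rule: infinite_finite_induct) (simp_all add: hom_one hom_mult)

lemma map_matrix_mult: "map_matrix h (A ** B) = map_matrix h A ** map_matrix h B"
  by (simp add: vec_eq_iff matrix_matrix_mult_def hom_sum hom_mult)

lemma map_matrix_mat_1: "map_matrix h (mat 1) = mat 1"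
  by (simp add: vec_eq_iff mat_def hom_zero hom_one)

lemma map_matrix_transpose: "map_matrix h (transpose A) = transpose (map_matrix h A)"
  by (simp add: vec_eq_iff transpose_def)

lemma map_matrix_uminus: "map_matrix h (- A) = - map_matrix h A"
  by (simp add: vec_eq_iff hom_uminus)

lemma det_map_matrix: "det (map_matrix h A) = h (det A)"
proof -
  have hom_sign: "h (of_int (sign p)) = of_int (sign p)" for p :: "'n \<Rightarrow> 'n"
    by (simp add: sign_def hom_one hom_uminus)
  show ?thesis
    by (simp add: det_def hom_sum hom_mult hom_prod hom_sign)
qed

lemma invertible_map_matrix: "invertible A \<Longrightarrow> invertible (map_matrix h A)"
  unfolding invertible_def by (metis map_matrix_mult map_matrix_mat_1)

lemma map_matrix_matrix_inv:
  assumes "invertible A"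
  shows "map_matrix h (matrix_inv A) = matrix_inv (map_matrix h (A :: 'a^'n^'n))"
proof (rule matrix_inv_unique[symmetric])
  show "map_matrix h (matrix_inv A) ** map_matrix h A = mat 1"
    using assms by (simp flip: map_matrix_mult add: matrix_inv_left map_matrix_mat_1)
qed

end

interpretation cnj: field_hom cnj
  by standard simp_all

interpretation of_real: field_hom complex_of_real
  by standard simp_all

lemma cnj_mat_cnj_mat: "cnj_mat (cnj_mat A) = A"
  by (simp add: vec_eq_iff)

lemma cnj_mat_cmat: "cnj_mat (cmat A) = cmat A"
  by (simp add: vec_eq_iff)

section \<open>Block-diagonal matrices, the Lorentz group and the involution\<close>

lemma bij_block_ix: "bij (block_ix :: (3 + 'n) option \<Rightarrow> 3 option + 'n)"
proof (rule bijI)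
  show "inj (block_ix :: (3 + 'n) option \<Rightarrow> 3 option + 'n)"
    by (rule injI) (auto simp: block_ix_def split: option.splits sum.splits)
  have "s \<in> range block_ix" for s :: "3 option + 'n"
  proof -
    have "s = block_ix (case s of Inl a \<Rightarrow> map_option Inl a | Inr b \<Rightarrow> Some (Inr b))"
      by (auto simp: block_ix_def split: option.splits sum.splits)
    then show ?thesis by blast
  qed
  then show "surj (block_ix :: (3 + 'n) option \<Rightarrow> 3 option + 'n)"
    by blast
qed

lemma sum_block_ix:
  fixes f :: "3 option + 'n::finite \<Rightarrow> 'a::comm_monoid_add"
  shows "(\<Sum>i\<in>UNIV. f (block_ix i)) = (\<Sum>a\<in>UNIV. f (Inl a)) + (\<Sum>b\<in>UNIV. f (Inr b))"
  using sum.reindex_bij_betw[OF bij_block_ix, of f] sum.Plus[of UNIV UNIV f]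
  by (simp add: comp_def)

lemma blockdiag_nth:
  "blockdiag A B $ i $ j = (case (block_ix i, block_ix j) of
     (Inl a, Inl b) \<Rightarrow> A $ a $ b
   | (Inr a, Inr b) \<Rightarrow> B $ a $ b
   | _ \<Rightarrow> 0)"
  by (simp add: blockdiag_def)

lemma blockdiag_mult:
  fixes A C :: "'a::semiring_1^(3 option)^(3 option)" and B D :: "'a^'n::finite^'n"
  shows "blockdiag A B ** blockdiag C D = blockdiag (A ** C) (B ** D)"
proof -
  have "(\<Sum>k\<in>UNIV. blockdiag A B $ i $ k * blockdiag C D $ k $ j)
      = blockdiag (A ** C) (B ** D) $ i $ j" for i j
    unfolding blockdiag_nth
    by (subst sum_block_ix) (simp add: matrix_matrix_mult_def split: sum.split)
  then show ?thesis
    by (simp add: vec_eq_iff matrix_matrix_mult_def)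
qed

lemma transpose_blockdiag: "transpose (blockdiag A B) = blockdiag (transpose A) (transpose B)"
  by (simp add: vec_eq_iff transpose_def blockdiag_nth split: sum.split)

lemma blockdiag_mat_1:
  "blockdiag (mat 1) (mat 1) = (mat 1 :: 'a::semiring_1^((3 + 'n::finite) option)^((3 + 'n) option))"
    (is "?L = ?R")
proof -
  have "?L $ i $ j = ?R $ i $ j" for i j
  proof -
    have "?L $ i $ j = (if block_ix i = block_ix j then 1 else 0)"
      by (simp add: blockdiag_nth mat_def split: sum.split)
    then show ?thesis
      by (simp add: mat_def inj_eq bij_is_inj bij_block_ix)
  qed
  then show ?thesis
    by (simp add: vec_eq_iff)
qed

lemma blockdiag_Ilor: "blockdiag Ilor (mat 1) = Ilor"
  by (auto simp: vec_eq_iff blockdiag_nth Ilor_def diag_mat_def mat_def block_ix_def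
      split: option.split sum.split)

lemma (in field_hom) map_matrix_blockdiag:
  "map_matrix h (blockdiag A B) = blockdiag (map_matrix h A) (map_matrix h B)"
  by (simp add: vec_eq_iff blockdiag_nth hom_zero split: sum.split)

lemma P2_eq_blockdiag: "P2 = blockdiag (mat 1) (diag_mat (\<lambda>j. if j = Min UNIV then - 1 else 1))"
  by (auto simp: vec_eq_iff P2_def blockdiag_nth diag_mat_def mat_def block_ix_def
      split: option.split sum.split)

lemma det_P2: "det P2 = - 1"
  by (simp add: P2_def det_diag_mat)

lemma Ilor_mult_Ilor: "Ilor ** Ilor = mat 1"
  unfolding Ilor_def diag_mat_mult diag_mat_1[symmetric]
  by (rule arg_cong[where f = diag_mat]) (auto split: option.split)

definition lorentz_group :: "('a::comm_ring_1^('m::finite option)^('m option)) set" where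
  "lorentz_group = {A. transpose A ** Ilor ** A = Ilor}"

lemma Oplus_subset_lorentz_group: "Oplus \<subseteq> lorentz_group"
  by (auto simp: Oplus_def lorentz_group_def)

lemma SOplusC_eq: "SOplusC = {A \<in> lorentz_group. det A = 1}"
  by (auto simp: SOplusC_def lorentz_group_def)

lemma lorentz_group_mult:
  assumes "A \<in> lorentz_group" "B \<in> lorentz_group"
  shows "A ** B \<in> lorentz_group"
proof -
  have "transpose (A ** B) ** Ilor ** (A ** B) = transpose B ** (transpose A ** Ilor ** A) ** B"
    by (simp only: matrix_transpose_mul matrix_mul_assoc)
  then show ?thesis
    using assms by (simp add: lorentz_group_def)
qed

lemma
  fixes A :: "'a::field^('m::finite option)^('m option)"
  assumes "A \<in> lorentz_group"
  shows matrix_inv_lorentz: "matrix_inv A = Ilor ** transpose A ** Ilor"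
    and invertible_lorentz: "invertible A"
proof -
  have "Ilor ** transpose A ** Ilor ** A = Ilor ** (transpose A ** Ilor ** A)"
    by (simp only: matrix_mul_assoc)
  also have "\<dots> = mat 1"
    using assms by (simp add: lorentz_group_def Ilor_mult_Ilor)
  finally have left_inverse: "Ilor ** transpose A ** Ilor ** A = mat 1" .
  then show "matrix_inv A = Ilor ** transpose A ** Ilor"
    by (rule matrix_inv_unique)
  show "invertible A"
    using left_inverse invertible_left_inverse by blast
qed

lemma invertible_Oplus: "A \<in> Oplus \<Longrightarrow> invertible A"
  using Oplus_subset_lorentz_group invertible_lorentz by blast

lemma lorentz_group_matrix_inv:
  fixes A :: "'a::field^('m::finite option)^('m option)"
  assumes "A \<in> lorentz_group"
  shows "matrix_inv A \<in> lorentz_group"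
proof -
  let ?B = "matrix_inv A"
  have "transpose A ** Ilor = Ilor ** ?B"
    by (simp add: matrix_inv_lorentz[OF assms] matrix_mul_assoc Ilor_mult_Ilor)
  then have "transpose ?B ** Ilor ** ?B = transpose ?B ** transpose A ** Ilor"
    by (simp flip: matrix_mul_assoc)
  also have "transpose ?B ** transpose A = mat 1"
    by (simp flip: matrix_transpose_mul
        add: matrix_inv_right[OF invertible_lorentz[OF assms]] transpose_mat)
  finally show ?thesis
    by (simp add: lorentz_group_def)
qed

lemma blockdiag_in_lorentz_group:
  fixes B :: "'a::comm_ring_1^'n::finite^'n"
  assumes "A \<in> lorentz_group" "transpose B ** B = mat 1"
  shows "blockdiag A B \<in> lorentz_group"
proof -
  have "transpose (blockdiag A B) ** blockdiag Ilor (mat 1) ** blockdiag A B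
      = blockdiag Ilor (mat 1)"
    using assms by (simp add: transpose_blockdiag blockdiag_mult lorentz_group_def)
  then show ?thesis
    by (simp add: lorentz_group_def blockdiag_Ilor)
qed

lemma P2_in_lorentz_group: "P2 \<in> lorentz_group"
  unfolding lorentz_group_def P2_def Ilor_def mem_Collect_eq transpose_diag_mat diag_mat_mult
  by (rule arg_cong[where f = diag_mat]) (auto split: option.split)

lemma (in field_hom) lorentz_group_map_matrix:
  assumes "A \<in> lorentz_group"
  shows "map_matrix h A \<in> lorentz_group"
proof -
  have map_Ilor: "map_matrix h Ilor = Ilor"
    by (auto simp: vec_eq_iff Ilor_def diag_mat_def hom_zero hom_one hom_uminus split: option.split)
  have "map_matrix h (transpose A ** Ilor ** A) = map_matrix h Ilor"
    using assms by (simp add: lorentz_group_def)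
  then show ?thesis
    by (simp add: lorentz_group_def map_matrix_mult map_matrix_transpose map_Ilor)
qed

lemma sigma_eq: "sigma A = blockdiag (- mat 1) (mat 1) ** A ** blockdiag (- mat 1) (mat 1)"
proof -
  have "matrix_inv (blockdiag (- mat 1) (mat 1) :: 'a^((3 + 'b) option)^((3 + 'b) option))
      = blockdiag (- mat 1) (mat 1)"
    by (rule matrix_inv_unique)
      (simp add: blockdiag_mult uminus_matrix_mult matrix_mult_uminus blockdiag_mat_1)
  then show ?thesis
    by (simp add: sigma_def)
qed

lemma sigma_blockdiag: "sigma (blockdiag A B) = blockdiag A B"
  by (simp add: sigma_eq blockdiag_mult uminus_matrix_mult matrix_mult_uminus)

lemma sigma_mult: "sigma (A ** B) = sigma A ** sigma B"
proof -
  let ?J = "blockdiag (- mat 1) (mat 1) :: 'a^((3 + 'b) option)^((3 + 'b) option)"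
  have "sigma A ** sigma B = ?J ** A ** (?J ** ?J) ** B ** ?J"
    by (simp only: sigma_eq matrix_mul_assoc)
  also have "?J ** ?J = mat 1"
    by (simp add: blockdiag_mult uminus_matrix_mult matrix_mult_uminus blockdiag_mat_1)
  finally show ?thesis
    by (simp add: sigma_eq matrix_mul_assoc)
qed

lemma sigma_matrix_inv:
  assumes "invertible A"
  shows "sigma (matrix_inv A) = matrix_inv (sigma A)"
proof (rule matrix_inv_unique[symmetric])
  show "sigma (matrix_inv A) ** sigma A = mat 1"
    using sigma_blockdiag[of "mat 1" "mat 1"]
    by (simp flip: sigma_mult add: matrix_inv_left[OF assms] blockdiag_mat_1)
qed

lemma (in field_hom) sigma_map_matrix: "sigma (map_matrix h A) = map_matrix h (sigma A)"
  by (simp add: sigma_eq map_matrix_mult map_matrix_blockdiag map_matrix_uminus map_matrix_mat_1)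

section \<open>Continuous, holomorphic and differentiable matrix functions\<close>

lemma continuous_on_matrix_mult:
  fixes f :: "'a::topological_space \<Rightarrow> 'b::real_normed_algebra_1^'n^'m"
  assumes "continuous_on S f" "continuous_on S g"
  shows "continuous_on S (\<lambda>x. f x ** g x)"
  unfolding matrix_matrix_mult_def by (intro continuous_intros assms)

lemma continuous_on_transpose:
  "continuous_on S f \<Longrightarrow> continuous_on S (\<lambda>x. transpose (f x))"
  unfolding transpose_def by (intro continuous_intros)

lemma continuous_on_cnj_mat: "continuous_on S f \<Longrightarrow> continuous_on S (\<lambda>x. cnj_mat (f x))"
  unfolding map_matrix_def by (intro continuous_intros)

lemma mat_holomorphic_on_const: "mat_holomorphic_on (\<lambda>z. A) U"
  by (simp add: mat_holomorphic_on_def)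

lemma mat_holomorphic_on_mult:
  assumes "mat_holomorphic_on f U" "mat_holomorphic_on g U"
  shows "mat_holomorphic_on (\<lambda>z. f z ** g z) U"
  using assms unfolding mat_holomorphic_on_def matrix_matrix_mult_def
  by (auto intro!: holomorphic_intros)

lemma mat_holomorphic_on_transpose:
  "mat_holomorphic_on f U \<Longrightarrow> mat_holomorphic_on (\<lambda>z. transpose (f z)) U"
  by (simp add: mat_holomorphic_on_def transpose_def)

lemma mat_holomorphic_on_subset:
  "mat_holomorphic_on f U \<Longrightarrow> V \<subseteq> U \<Longrightarrow> mat_holomorphic_on f V"
  unfolding mat_holomorphic_on_def using holomorphic_on_subset by blast

lemma mat_holomorphic_on_cong:
  "(\<And>z. z \<in> U \<Longrightarrow> f z = g z) \<Longrightarrow> mat_holomorphic_on f U \<longleftrightarrow> mat_holomorphic_on g U"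
  unfolding mat_holomorphic_on_def by (intro all_cong1 holomorphic_cong) simp_all

lemma mat_holomorphic_on_matrix_inv_lorentz:
  assumes "mat_holomorphic_on f U" "\<And>z. z \<in> U \<Longrightarrow> f z \<in> lorentz_group"
  shows "mat_holomorphic_on (\<lambda>z. matrix_inv (f z)) U"
proof -
  have "mat_holomorphic_on (\<lambda>z. Ilor ** transpose (f z) ** Ilor) U"
    by (intro mat_holomorphic_on_mult mat_holomorphic_on_transpose mat_holomorphic_on_const assms)
  then show ?thesis
    by (subst mat_holomorphic_on_cong) (simp_all add: matrix_inv_lorentz assms(2))
qed

lemma mat_holomorphic_on_cnj_compose:
  assumes f: "mat_holomorphic_on f V" "open V"
    and \<mu>: "(\<lambda>z. cnj (\<mu> z)) holomorphic_on U" "\<mu> ` U \<subseteq> V"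
  shows "mat_holomorphic_on (\<lambda>z. cnj_mat (f (\<mu> z))) U"
  unfolding mat_holomorphic_on_def
proof (intro allI)
  fix i j
  have "open (cnj ` V)"
    unfolding image_cnj_conv_vimage_cnj using f(2) by (intro open_vimage) auto
  then have "cnj \<circ> (\<lambda>z. f z $ i $ j) \<circ> cnj holomorphic_on cnj ` V"
    using f(1) by (intro holomorphic_on_compose_cnj_cnj)
      (simp_all add: mat_holomorphic_on_def image_image)
  with \<mu>(1) have "(cnj \<circ> (\<lambda>z. f z $ i $ j) \<circ> cnj) \<circ> (\<lambda>z. cnj (\<mu> z)) holomorphic_on U"
    by (rule holomorphic_on_compose_gen) (use \<mu>(2) in auto)
  then show "(\<lambda>z. cnj_mat (f (\<mu> z)) $ i $ j) holomorphic_on U"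
    by (simp add: comp_def)
qed

lemma differentiable_vec_componentwise:
  fixes f :: "'a::euclidean_space \<Rightarrow> 'b::euclidean_space^'n"
  assumes "\<And>i. (\<lambda>x. f x $ i) differentiable (at a within S)"
  shows "f differentiable (at a within S)"
proof (subst differentiable_componentwise_within, intro ballI)
  fix b :: "'b^'n" assume "b \<in> Basis"
  then obtain i c where "b = axis i c"
    by (auto simp: Basis_vec_def)
  then show "(\<lambda>x. f x \<bullet> b) differentiable (at a within S)"
    using assms[of i] by (simp add: inner_axis differentiable_inner)
qed

lemma mat_holomorphic_on_imp_differentiable:
  assumes "mat_holomorphic_on f U" "open U" "z \<in> U"
  shows "f differentiable (at z)"
  using assms unfolding mat_holomorphic_on_def
  by (intro differentiable_vec_componentwise field_differentiable_imp_differentiable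
      holomorphic_on_imp_differentiable_at) auto

lemma bounded_linear_cnj_mat: "bounded_linear (cnj_mat :: complex^'n^'m \<Rightarrow> complex^'n^'m)"
  unfolding linear_conv_bounded_linear[symmetric]
  by (auto intro!: linearI simp: vec_eq_iff)

lemma bounded_bilinear_matrix_mult:
  "bounded_bilinear ((**) :: 'a::{euclidean_space,real_algebra_1}^'n^'m \<Rightarrow> 'a^'k^'n \<Rightarrow> 'a^'k^'m)"
  unfolding bilinear_conv_bounded_bilinear[symmetric] bilinear_def
  by (auto intro!: linearI simp: vec_eq_iff matrix_matrix_mult_def algebra_simps sum.distrib
      scaleR_sum_right)

lemma differentiable_cnj_mat:
  assumes "f differentiable (at z within S)"
  shows "(\<lambda>w. cnj_mat (f w)) differentiable (at z within S)"
  using bounded_linear_imp_differentiable[OF bounded_linear_cnj_mat] assms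
  by (rule differentiable_compose)

lemma differentiable_matrix_mult:
  fixes f :: "'b::real_normed_vector \<Rightarrow> 'a::{euclidean_space,real_algebra_1}^'n^'m"
  assumes "f differentiable (at x within S)" "g differentiable (at x within S)"
  shows "(\<lambda>x. f x ** g x) differentiable (at x within S)"
  using assms bounded_bilinear.FDERIV[OF bounded_bilinear_matrix_mult]
  unfolding differentiable_def by blast

section \<open>Logarithmic derivatives\<close>

lemma mc_form_cong:
  assumes "A differentiable (at z)" "open U" "z \<in> U" "\<And>w. w \<in> U \<Longrightarrow> A w = B w"
  shows "mc_form A z v = mc_form B z v"
  using frechet_derivative_transform_within_open[OF assms] assms(3,4) by (simp add: mc_form_def)

lemma mc_form_compose:
  assumes "\<mu> differentiable (at z)" "A differentiable (at (\<mu> z))"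
  shows "mc_form (\<lambda>w. A (\<mu> w)) z v = pullback \<mu> (mc_form A) z v"
  using frechet_derivative_compose[OF assms] by (simp add: mc_form_def pullback_def comp_def)

lemma mc_form_cnj_mat:
  assumes "A differentiable (at z)" "invertible (A z)"
  shows "mc_form (\<lambda>w. cnj_mat (A w)) z v = cnj_mat (mc_form A z v)"
proof -
  have "((\<lambda>w. cnj_mat (A w)) has_derivative (\<lambda>v. cnj_mat (frechet_derivative A (at z) v))) (at z)"
    using assms(1) unfolding frechet_derivative_works
    by (rule bounded_linear.has_derivative[OF bounded_linear_cnj_mat])
  from frechet_derivative_at[OF this, symmetric] show ?thesis
    by (simp add: mc_form_def cnj.map_matrix_mult cnj.map_matrix_matrix_inv[OF assms(2)])
qed

lemma mc_form_mult:
  assumes diff: "A differentiable (at z)" "B differentiable (at z)"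
    and inv: "invertible (A z)" "invertible (B z)"
  shows "mc_form (\<lambda>w. A w ** B w) z v = (mc_form A \<sharp> B) z v"
proof -
  let ?A' = "frechet_derivative A (at z)" and ?B' = "frechet_derivative B (at z)"
  have "((\<lambda>w. A w ** B w) has_derivative (\<lambda>v. A z ** ?B' v + ?A' v ** B z)) (at z)"
    using diff unfolding frechet_derivative_works
    by (rule bounded_bilinear.FDERIV[OF bounded_bilinear_matrix_mult])
  from frechet_derivative_at[OF this, symmetric]
  have "mc_form (\<lambda>w. A w ** B w) z v
      = matrix_inv (B z) ** matrix_inv (A z) ** (A z ** ?B' v + ?A' v ** B z)"
    by (simp add: mc_form_def matrix_inv_mult[OF inv])
  also have "\<dots> = matrix_inv (B z) ** (matrix_inv (A z) ** A z) ** ?B' v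
      + matrix_inv (B z) ** (matrix_inv (A z) ** ?A' v) ** B z"
    by (simp only: matrix_add_ldistrib matrix_mul_assoc)
  finally show ?thesis
    by (simp add: gauge_def mc_form_def matrix_inv_left[OF inv(1)] add.commute)
qed

lemma mc_form_const_mult:
  assumes "A differentiable (at z)" "invertible C" "invertible (A z)"
  shows "mc_form (\<lambda>w. C ** A w) z v = mc_form A z v"
  using mc_form_mult[of "\<lambda>_. C" z A v] assms by (simp add: gauge_def mc_form_def)

section \<open>Plus loops\<close>

lemma inverse_in_unit_sphere:
  "l \<in> sphere 0 1 \<Longrightarrow> inverse l \<in> sphere (0::'a::real_normed_div_algebra) 1"
  by (simp add: norm_inverse)

lemma cnj_eq_inverse_on_unit_sphere: "l \<in> sphere 0 1 \<Longrightarrow> cnj l = inverse l"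
  by (rule inverse_unique[symmetric]) (simp flip: complex_norm_square)

lemma extends_inside_const: "extends_inside (\<lambda>l. A) (\<lambda>l. A)"
  by (simp add: extends_inside_def mat_holomorphic_on_const)

lemma extends_inside_mult:
  assumes "extends_inside \<gamma> g" "extends_inside \<delta> h"
  shows "extends_inside (\<lambda>l. \<gamma> l ** \<delta> l) (\<lambda>l. g l ** h l)"
  using assms unfolding extends_inside_def
  by (auto intro!: continuous_on_matrix_mult mat_holomorphic_on_mult)

text \<open>Inside the disk \<open>g l\<close> need not lie in the Lorentz group, nor even be invertible.\<close>

lemma extends_inside_matrix_inv_lorentz:
  assumes "extends_inside \<gamma> g" "\<And>l. l \<in> sphere 0 1 \<Longrightarrow> \<gamma> l \<in> lorentz_group"
  shows "extends_inside (\<lambda>l. matrix_inv (\<gamma> l)) (\<lambda>l. Ilor ** transpose (g l) ** Ilor)"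
  using assms unfolding extends_inside_def
  by (auto simp: matrix_inv_lorentz intro!: continuous_on_matrix_mult continuous_on_transpose
      mat_holomorphic_on_mult mat_holomorphic_on_transpose mat_holomorphic_on_const)

lemma extends_inside_schwarz_reflection:
  assumes "extends_inside \<gamma> g"
  shows "extends_inside (\<lambda>l. cnj_mat (\<gamma> (inverse l))) (\<lambda>l. cnj_mat (g (cnj l)))"
  unfolding extends_inside_def
proof (intro conjI ballI)
  have "continuous_on (cball 0 1) (\<lambda>l. g (cnj l))"
    using assms by (intro continuous_on_compose2[of "cball 0 1" g _ cnj])
      (auto simp: extends_inside_def intro!: continuous_on_cnj)
  then show "continuous_on (cball 0 1) (\<lambda>l. cnj_mat (g (cnj l)))"
    by (rule continuous_on_cnj_mat)
  show "mat_holomorphic_on (\<lambda>l. cnj_mat (g (cnj l))) (ball 0 1)"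
    using assms by (intro mat_holomorphic_on_cnj_compose[of g "ball 0 1"])
      (auto simp: extends_inside_def)
  show "cnj_mat (g (cnj l)) = cnj_mat (\<gamma> (inverse l))" if "l \<in> sphere 0 1" for l
    using assms that inverse_in_unit_sphere[OF that]
    by (simp add: extends_inside_def cnj_eq_inverse_on_unit_sphere)
qed

lemma loop_plus_iff:
  "\<gamma> \<in> loop_plus G \<longleftrightarrow>
    (\<exists>g. extends_inside \<gamma> g) \<and> (\<forall>l\<in>sphere 0 1. \<gamma> l \<in> G \<and> sigma (\<gamma> l) = \<gamma> (- l))"
proof -
  have "continuous_on (sphere 0 1) \<gamma>" if "extends_inside \<gamma> g" for g
  proof -
    have "continuous_on (sphere 0 1) g"
      using that by (auto simp: extends_inside_def intro: continuous_on_subset)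
    then show ?thesis
      using that by (subst continuous_on_cong[of _ _ _ g]) (auto simp: extends_inside_def)
  qed
  then show ?thesis
    by (auto simp: loop_plus_def loop_group_def)
qed

lemma loop_plus_memD: "\<gamma> \<in> loop_plus G \<Longrightarrow> l \<in> sphere 0 1 \<Longrightarrow> \<gamma> l \<in> G"
  by (simp add: loop_plus_iff)

lemma loop_plus_SOplusC_iff:
  "\<gamma> \<in> loop_plus SOplusC \<longleftrightarrow> \<gamma> \<in> loop_plus lorentz_group \<and> (\<forall>l\<in>sphere 0 1. det (\<gamma> l) = 1)"
  by (auto simp: loop_plus_iff SOplusC_eq)

lemma loop_plus_const:
  assumes "A \<in> G" "sigma A = A"
  shows "(\<lambda>l. A) \<in> loop_plus G"
  using assms extends_inside_const by (auto simp: loop_plus_iff)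

lemma loop_plus_mult:
  assumes "\<gamma> \<in> loop_plus lorentz_group" "\<delta> \<in> loop_plus lorentz_group"
  shows "(\<lambda>l. \<gamma> l ** \<delta> l) \<in> loop_plus lorentz_group"
  using assms extends_inside_mult unfolding loop_plus_iff
  by (fastforce simp: sigma_mult lorentz_group_mult)

lemma loop_plus_matrix_inv:
  assumes "\<gamma> \<in> loop_plus lorentz_group"
  shows "(\<lambda>l. matrix_inv (\<gamma> l)) \<in> loop_plus lorentz_group"
  using assms extends_inside_matrix_inv_lorentz unfolding loop_plus_iff
  by (fastforce simp: sigma_matrix_inv invertible_lorentz lorentz_group_matrix_inv)

lemma loop_plus_cnj_inverse:
  assumes "\<gamma> \<in> loop_plus lorentz_group"
  shows "(\<lambda>l. cnj_mat (\<gamma> (inverse l))) \<in> loop_plus lorentz_group"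
  using assms extends_inside_schwarz_reflection inverse_in_unit_sphere unfolding loop_plus_iff
  by (fastforce simp: cnj.sigma_map_matrix cnj.lorentz_group_map_matrix)

lemma P2_mult_in_loop_plus_SOplusC:
  fixes \<gamma> :: "complex \<Rightarrow> complex^((3 + 'n::{finite,linorder}) option)^((3 + 'n) option)"
  assumes "\<gamma> \<in> loop_plus lorentz_group" "\<And>l. l \<in> sphere 0 1 \<Longrightarrow> det (\<gamma> l) = - 1"
  shows "(\<lambda>l. P2 ** \<gamma> l) \<in> loop_plus SOplusC"
proof -
  have "(\<lambda>l. P2 ** \<gamma> l) \<in> loop_plus lorentz_group"
    by (intro loop_plus_mult loop_plus_const P2_in_lorentz_group assms)
      (simp add: P2_eq_blockdiag sigma_blockdiag)
  then show ?thesis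
    by (simp add: loop_plus_SOplusC_iff assms(2) det_mul det_P2)
qed

lemma O13_On_const_in_loop_plus:
  fixes K :: "real^((3 + 'n::finite) option)^((3 + 'n) option)"
  assumes "K \<in> O13_On"
  shows "(\<lambda>l. cmat K) \<in> loop_plus lorentz_group"
proof -
  obtain A B where K: "K = blockdiag A B" and "A \<in> lorentz_group" "transpose B ** B = mat 1"
    using assms Oplus_subset_lorentz_group by (auto simp: O13_On_def orthogonal_matrix_def)
  then have "K \<in> lorentz_group" "sigma K = K"
    by (simp_all add: blockdiag_in_lorentz_group sigma_blockdiag)
  then show ?thesis
    by (intro loop_plus_const)
      (simp_all add: of_real.lorentz_group_map_matrix of_real.sigma_map_matrix)
qed

section \<open>Symmetric Birkhoff decompositions\<close>

locale birkhoff_symmetry =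
  fixes D X :: "complex set" and \<mu> :: "complex \<Rightarrow> complex"
    and M k :: "complex \<Rightarrow> real^((3 + 'n::finite) option)^((3 + 'n) option)"
    and F :: "complex \<Rightarrow> complex \<Rightarrow> real^((3 + 'n) option)^((3 + 'n) option)"
    and Fm Fp :: "complex \<Rightarrow> complex \<Rightarrow> complex^((3 + 'n) option)^((3 + 'n) option)"
  assumes open_D: "open D"
    and \<mu>_in_D: "z \<in> D \<Longrightarrow> \<mu> z \<in> D"
    and cnj_\<mu>_holomorphic: "(\<lambda>z. cnj (\<mu> z)) holomorphic_on D"
    and invertible_M: "l \<in> sphere 0 1 \<Longrightarrow> invertible (M l)"
    and k_in_O13_On: "z \<in> D \<Longrightarrow> k z \<in> O13_On"
    and F_symmetry: "z \<in> D \<Longrightarrow> l \<in> sphere 0 1 \<Longrightarrow> F (\<mu> z) l = M l ** F z (inverse l) ** k z"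
    and birkhoff: "birkhoff_decomposition D X F Fm Fp"
begin

abbreviation regular_set :: "complex set" where
  "regular_set \<equiv> {z \<in> D. z \<notin> X \<and> \<mu> z \<notin> X}"

abbreviation W :: "complex \<Rightarrow> complex \<Rightarrow> complex^((3 + 'n) option)^((3 + 'n) option)" where
  "W \<equiv> W_plus \<mu> k Fp"

lemma F_eq_Fm_Fp: "z \<in> D - X \<Longrightarrow> l \<in> sphere 0 1 \<Longrightarrow> cmat (F z l) = Fm z l ** Fp z l"
  using birkhoff by (simp add: birkhoff_decomposition_def)

lemma Fm_in_SOplusC: "z \<in> D - X \<Longrightarrow> l \<in> sphere 0 1 \<Longrightarrow> Fm z l \<in> SOplusC"
  using birkhoff by (simp add: birkhoff_decomposition_def loop_minus_star_def loop_group_def)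

lemma Fm_in_lorentz_group: "z \<in> D - X \<Longrightarrow> l \<in> sphere 0 1 \<Longrightarrow> Fm z l \<in> lorentz_group"
  using Fm_in_SOplusC by (simp add: SOplusC_eq)

lemma invertible_Fm: "z \<in> D - X \<Longrightarrow> l \<in> sphere 0 1 \<Longrightarrow> invertible (Fm z l)"
  using Fm_in_lorentz_group invertible_lorentz by blast

lemma Fp_in_loop_plus: "z \<in> D - X \<Longrightarrow> Fp z \<in> loop_plus SOplusC"
  using birkhoff by (simp add: birkhoff_decomposition_def)

lemma invertible_Fp:
  assumes "z \<in> D - X" "l \<in> sphere 0 1"
  shows "invertible (Fp z l)"
  using loop_plus_memD[OF Fp_in_loop_plus[OF assms(1)] assms(2)]
  by (simp add: SOplusC_eq invertible_lorentz)

lemma \<mu>_regular: "z \<in> regular_set \<Longrightarrow> \<mu> z \<in> D - X"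
  using \<mu>_in_D by blast

lemma Fm_symmetry:
  assumes "z \<in> regular_set" "l \<in> sphere 0 1"
  shows "Fm (\<mu> z) l = cmat (M l) ** cnj_mat (Fm z (inverse l)) ** W z l"
proof -
  have z: "z \<in> D - X" and \<mu>z: "\<mu> z \<in> D - X" and l: "inverse l \<in> sphere 0 1"
    using assms \<mu>_regular inverse_in_unit_sphere by blast+
  have F_real: "cmat (F z (inverse l)) = cnj_mat (Fm z (inverse l)) ** cnj_mat (Fp z (inverse l))"
    using F_eq_Fm_Fp[OF z l] by (metis cnj_mat_cmat cnj.map_matrix_mult)
  have "Fm (\<mu> z) l = cmat (F (\<mu> z) l) ** matrix_inv (Fp (\<mu> z) l)"
    using invertible_Fp[OF \<mu>z assms(2)]
    by (simp add: F_eq_Fm_Fp[OF \<mu>z assms(2)] matrix_inv_right flip: matrix_mul_assoc)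
  also have "\<dots> = cmat (M l) ** (cmat (F z (inverse l)) ** cmat (k z)) ** matrix_inv (Fp (\<mu> z) l)"
    using z by (simp add: F_symmetry[OF _ assms(2)] of_real.map_matrix_mult matrix_mul_assoc)
  also have "\<dots> = cmat (M l) ** cnj_mat (Fm z (inverse l)) ** W z l"
    by (simp add: F_real W_plus_def matrix_mul_assoc)
  finally show ?thesis .
qed

lemma W_in_loop_plus:
  assumes "z \<in> regular_set"
  shows "W z \<in> loop_plus lorentz_group"
proof -
  have "Fp w \<in> loop_plus lorentz_group" if "w \<in> D - X" for w
    using Fp_in_loop_plus[OF that] by (simp add: loop_plus_SOplusC_iff)
  then show ?thesis
    using assms \<mu>_regular[OF assms] unfolding W_plus_def
    by (intro loop_plus_mult loop_plus_cnj_inverse loop_plus_matrix_inv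
        O13_On_const_in_loop_plus k_in_O13_On) auto
qed

lemma det_W:
  assumes "z \<in> regular_set" "l \<in> sphere 0 1"
  shows "complex_of_real (det (M 1)) * det (W z l) = 1"
proof -
  have z: "z \<in> D - X" and \<mu>z: "\<mu> z \<in> D - X"
    using assms \<mu>_regular by blast+
  have det_Fp: "det (Fp w l') = 1" if "w \<in> D - X" "l' \<in> sphere 0 1" for w l'
    using Fp_in_loop_plus[OF that(1)] that(2) by (simp add: loop_plus_SOplusC_iff)
  have det_F: "det (F w 1) = 1" if "w \<in> D - X" for w
  proof -
    have "complex_of_real (det (F w 1)) = det (Fm w 1) * det (Fp w 1)"
      using F_eq_Fm_Fp[OF that, of 1] by (simp flip: of_real.det_map_matrix det_mul)
    then show ?thesis
      using Fm_in_SOplusC[OF that, of 1] det_Fp[OF that, of 1] by (simp add: SOplusC_eq)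
  qed
  have "det (F (\<mu> z) 1) = det (M 1) * det (F z 1) * det (k z)"
    using F_symmetry[of z 1] z by (simp add: det_mul)
  then have "det (M 1) * det (k z) = 1"
    by (simp add: det_F[OF z] det_F[OF \<mu>z])
  moreover have "det (W z l) = complex_of_real (det (k z))"
    using det_Fp[OF z inverse_in_unit_sphere[OF assms(2)]] det_Fp[OF \<mu>z assms(2)]
      invertible_Fp[OF \<mu>z assms(2)]
    by (simp add: W_plus_def det_mul det_matrix_inv cnj.det_map_matrix of_real.det_map_matrix)
  ultimately show ?thesis
    by (simp flip: of_real_mult)
qed

lemma open_D_diff_X: "open (D - X)"
  using birkhoff open_D open_diff_sparse_pts by (auto simp: birkhoff_decomposition_def)

lemma open_regular_set: "open regular_set"
proof -
  have "continuous_on D (\<lambda>z. cnj (cnj (\<mu> z)))"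
    by (intro continuous_on_cnj holomorphic_on_imp_continuous_on cnj_\<mu>_holomorphic)
  then have "open (D \<inter> \<mu> -` (D - X))"
    using open_D open_D_diff_X by (simp add: continuous_open_preimage)
  then have "open ((D - X) \<inter> (D \<inter> \<mu> -` (D - X)))"
    using open_D_diff_X by blast
  also have "(D - X) \<inter> (D \<inter> \<mu> -` (D - X)) = regular_set"
    using \<mu>_in_D by blast
  finally show ?thesis .
qed

lemma Fm_holomorphic: "l \<in> sphere 0 1 \<Longrightarrow> mat_holomorphic_on (\<lambda>z. Fm z l) (D - X)"
  using birkhoff by (simp add: birkhoff_decomposition_def)

lemma cnj_W_eq:
  assumes z: "z \<in> regular_set" and l: "l \<in> sphere 0 1"
  shows "cnj_mat (W z l)
    = matrix_inv (Fm z (inverse l)) ** cmat (matrix_inv (M l)) ** cnj_mat (Fm (\<mu> z) l)"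
proof -
  let ?A = "Fm z (inverse l)" and ?M = "cmat (M l)"
  have inv: "invertible ?A" "invertible ?M"
    using z invertible_Fm[OF _ inverse_in_unit_sphere[OF l]] invertible_M[OF l]
    by (auto intro: of_real.invertible_map_matrix)
  have "cnj_mat (Fm (\<mu> z) l) = ?M ** ?A ** cnj_mat (W z l)"
    by (simp add: Fm_symmetry[OF z l] cnj.map_matrix_mult cnj_mat_cnj_mat cnj_mat_cmat)
  then have "matrix_inv ?A ** matrix_inv ?M ** cnj_mat (Fm (\<mu> z) l)
      = matrix_inv ?A ** (matrix_inv ?M ** ?M) ** ?A ** cnj_mat (W z l)"
    by (simp only: matrix_mul_assoc)
  then show ?thesis
    using inv by (simp add: matrix_inv_left of_real.map_matrix_matrix_inv invertible_M[OF l])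
qed

lemma cnj_W_holomorphic:
  assumes "l \<in> sphere 0 1"
  shows "mat_holomorphic_on (\<lambda>z. cnj_mat (W z l)) regular_set"
proof -
  note inverse_l = inverse_in_unit_sphere[OF assms]
  have "mat_holomorphic_on (\<lambda>z. cnj_mat (Fm (\<mu> z) l)) regular_set"
    by (rule mat_holomorphic_on_cnj_compose[OF Fm_holomorphic[OF assms] open_D_diff_X
          holomorphic_on_subset[OF cnj_\<mu>_holomorphic]]) (use \<mu>_regular in auto)
  moreover have "mat_holomorphic_on (\<lambda>z. matrix_inv (Fm z (inverse l))) regular_set"
    using Fm_in_lorentz_group[OF _ inverse_l]
    by (intro mat_holomorphic_on_matrix_inv_lorentz
        mat_holomorphic_on_subset[OF Fm_holomorphic[OF inverse_l]]) auto
  ultimately have "mat_holomorphic_on (\<lambda>z. matrix_inv (Fm z (inverse l))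
      ** cmat (matrix_inv (M l)) ** cnj_mat (Fm (\<mu> z) l)) regular_set"
    by (intro mat_holomorphic_on_mult mat_holomorphic_on_const)
  then show ?thesis
    by (subst mat_holomorphic_on_cong[OF cnj_W_eq[OF _ assms]])
qed

lemma \<mu>_differentiable:
  assumes "z \<in> D"
  shows "\<mu> differentiable (at z)"
proof -
  have "(\<lambda>w. cnj (\<mu> w)) differentiable (at z)"
    using cnj_\<mu>_holomorphic open_D assms
    by (auto intro: field_differentiable_imp_differentiable holomorphic_on_imp_differentiable_at)
  then have "(\<lambda>w. cnj (cnj (\<mu> w))) differentiable (at z)"
    by (rule differentiable_compose[OF bounded_linear_imp_differentiable[OF bounded_linear_cnj]])
  then show ?thesis by simp
qed

lemma Fm_differentiable:
  "z \<in> D - X \<Longrightarrow> l \<in> sphere 0 1 \<Longrightarrow> (\<lambda>w. Fm w l) differentiable (at z)"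
  by (rule mat_holomorphic_on_imp_differentiable[OF Fm_holomorphic open_D_diff_X])

lemma W_differentiable:
  assumes "z \<in> regular_set" "l \<in> sphere 0 1"
  shows "(\<lambda>w. W w l) differentiable (at z)"
proof -
  have "(\<lambda>w. cnj_mat (cnj_mat (W w l))) differentiable (at z)"
    by (intro differentiable_cnj_mat
        mat_holomorphic_on_imp_differentiable[OF cnj_W_holomorphic open_regular_set] assms)
  then show ?thesis
    by (simp add: cnj_mat_cnj_mat)
qed

lemma pullback_normalized_potential:
  assumes z: "z \<in> regular_set" and l: "l \<in> sphere 0 1"
  shows "pullback \<mu> (normalized_potential Fm l) z v
    = ((\<lambda>z v. cnj_mat (normalized_potential Fm (inverse l) z v)) \<sharp> (\<lambda>z. W z l)) z v"
proof -
  let ?A = "\<lambda>w. Fm w (inverse l)" and ?M = "cmat (M l)"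
  have z': "z \<in> D" "z \<in> D - X" and l': "inverse l \<in> sphere 0 1"
    using z inverse_in_unit_sphere[OF l] by auto
  note Fm_\<mu>_diff = Fm_differentiable[OF \<mu>_regular[OF z] l]
  have A_diff: "?A differentiable (at z)" and A_inv: "invertible (?A z)"
    using z' l' by (auto intro: Fm_differentiable invertible_Fm)
  have M_inv: "invertible ?M" and W_inv: "invertible (W z l)"
    using invertible_M[OF l] loop_plus_memD[OF W_in_loop_plus[OF z] l]
    by (auto intro: invertible_lorentz of_real.invertible_map_matrix)
  have "pullback \<mu> (normalized_potential Fm l) z v = mc_form (\<lambda>w. Fm (\<mu> w) l) z v"
    unfolding normalized_potential_def
    by (rule mc_form_compose[OF \<mu>_differentiable[OF z'(1)] Fm_\<mu>_diff, symmetric])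
  also have "\<dots> = mc_form (\<lambda>w. ?M ** cnj_mat (?A w) ** W w l) z v"
    by (rule mc_form_cong[OF differentiable_compose[OF Fm_\<mu>_diff \<mu>_differentiable[OF z'(1)]]
          open_regular_set z Fm_symmetry[OF _ l]])
  also have "\<dots> = (mc_form (\<lambda>w. ?M ** cnj_mat (?A w)) \<sharp> (\<lambda>w. W w l)) z v"
    by (intro mc_form_mult differentiable_matrix_mult differentiable_const differentiable_cnj_mat
        A_diff W_differentiable z l invertible_mult cnj.invertible_map_matrix A_inv M_inv W_inv)
  also have "\<dots> = ((\<lambda>z v. cnj_mat (mc_form ?A z v)) \<sharp> (\<lambda>w. W w l)) z v"
    by (simp add: gauge_def mc_form_const_mult mc_form_cnj_mat differentiable_cnj_mat A_diff
        cnj.invertible_map_matrix A_inv M_inv)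
  finally show ?thesis
    by (simp only: normalized_potential_def)
qed

end

theorem theorem3p4:
  fixes D X :: "complex set" and z0 :: complex
    and y :: "complex \<Rightarrow> real^(3 + 'n::{finite,linorder})"
    and f :: "complex \<Rightarrow> (real^((3 + 'n) option)^((3 + 'n) option)) set"
    and \<mu> :: "complex \<Rightarrow> complex" and S :: "real^(3 + 'n) \<Rightarrow> real^(3 + 'n)"
    and Shat :: "real^((3 + 'n) option)^((3 + 'n) option)"
    and F0 k :: "complex \<Rightarrow> real^((3 + 'n) option)^((3 + 'n) option)"
    and F :: "complex \<Rightarrow> complex \<Rightarrow> real^((3 + 'n) option)^((3 + 'n) option)"
    and M :: "complex \<Rightarrow> real^((3 + 'n) option)^((3 + 'n) option)"
    and Fm Fp :: "complex \<Rightarrow> complex \<Rightarrow> complex^((3 + 'n) option)^((3 + 'n) option)"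
  assumes D: "D = ball 0 1 \<or> D = UNIV" and z0: "z0 \<in> D"
    and willmore: "willmore_surface D y"
    and gauss_map: "conformal_gauss_map D y f"
    and symmetry: "orientation_reversing_symmetry D y \<mu> S"
    and Shat: "Shat \<in> Oplus" "induces Shat S"
    and frame: "gauss_frame D y f F0" "F0 z0 = mat 1"
    and ext_frame: "extended_frame D z0 F0 F"
    and M: "M \<in> loop_group Oplus" "M 1 = Shat"
    and k: "\<And>z. z \<in> D \<Longrightarrow> k z \<in> O13_On"
    and Mk: "\<And>z l. z \<in> D \<Longrightarrow> l \<in> sphere 0 1 \<Longrightarrow> F (\<mu> z) l = M l ** F z (inverse l) ** k z"
    and birkhoff: "birkhoff_decomposition D X F Fm Fp"
  shows "let W = W_plus \<mu> k Fp;
             \<eta> = normalized_potential Fm;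
             \<Omega> = {z \<in> D. z \<notin> X \<and> \<mu> z \<notin> X}
         in
         (\<forall>z\<in>\<Omega>. \<forall>l\<in>sphere 0 1.
            Fm (\<mu> z) l = cmat (M l) ** cnj_mat (Fm z (inverse l)) ** W z l) \<and>
         (\<forall>l\<in>sphere 0 1. mat_holomorphic_on (\<lambda>z. cnj_mat (W z l)) \<Omega>) \<and>
         (\<forall>z\<in>\<Omega>. \<forall>l\<in>sphere 0 1. \<forall>v.
            pullback \<mu> (\<eta> l) z v = ((\<lambda>z v. cnj_mat (\<eta> (inverse l) z v)) \<sharp> (\<lambda>z. W z l)) z v) \<and>
         (det Shat = 1 \<longrightarrow> (\<forall>z\<in>\<Omega>. W z \<in> loop_plus SOplusC)) \<and>
         (det Shat = - 1 \<longrightarrow> (\<forall>z\<in>\<Omega>. (\<lambda>l. P2 ** W z l) \<in> loop_plus SOplusC))"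
proof -
  have "antiholomorphic_automorphism D \<mu>"
    using symmetry by (simp add: orientation_reversing_symmetry_def)
  then interpret birkhoff_symmetry D X \<mu> M k F Fm Fp
  proof unfold_locales
    show "open D"
      using D by auto
    show "invertible (M l)" if "l \<in> sphere 0 1" for l
      using M(1) that by (simp add: loop_group_def invertible_Oplus)
  qed (use k Mk birkhoff in \<open>auto simp: antiholomorphic_automorphism_def intro: bij_betw_apply\<close>)
  have "W z \<in> loop_plus SOplusC" if "det Shat = 1" "z \<in> regular_set" for z
    using W_in_loop_plus[OF that(2)] det_W[OF that(2)] that(1) M(2)
    by (simp add: loop_plus_SOplusC_iff)
  moreover have "(\<lambda>l. P2 ** W z l) \<in> loop_plus SOplusC"
    if "det Shat = - 1" "z \<in> regular_set" for z
    using det_W[OF that(2)] that(1) M(2)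
    by (intro P2_mult_in_loop_plus_SOplusC W_in_loop_plus[OF that(2)])
      (simp add: minus_equation_iff)
  ultimately show ?thesis
    unfolding Let_def using Fm_symmetry cnj_W_holomorphic pullback_normalized_potential by blast
qed

end
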